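(* Let $X$ be a compact topological space with a Radon measure $\mu$, and let $B$ be a Banach space. Assume that the continuous kernel $K\colon X^2\times B\to B$ fulfills the Lipschitz condition $$\|K(t,s,x)-K(t,s,y)\|\leq L(t,s)\,\|x-y\|$$ for all $t,s\in X$ and $x,y\in B$, with a continuous function $L\colon X^2\to\mathbb{R}_+$. Let $f\in\mathscr{C}(X,B)$. If there exists a positive continuous function $\ell\colon X\to\mathbb{R}_+$ such that $$\int_XL(t,s)\,\ell(s)\,d\mu(s)<\ell(t)\qquad\text{for all }t\in X,$$ then the nonlinear Fredholm-type equation $$x(t)=f(t)+\int_XK(t,s,x(s))\,d\mu(s)\qquad(t\in X)$$ has a unique solution $x$ in $\mathscr{C}(X,B)$.
   Context: $\mathbb{R}_+$ denotes the set of positive reals. $\mathscr{C}(X,B)$ is the set of continuous maps from $X$ to $B$. Integrals of $B$-valued functions are Bochner integrals. *)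

theory Defs
  imports "HOL-Analysis.Analysis"
begin

text \<open>
  The Hausdorff property is not part of the definition. In a Hausdorff space compact sets are Borel
  sets, so the condition \<open>C \<in> sets borel\<close> is redundant there; otherwise it is needed because
  \<^const>\<open>emeasure\<close> is \<open>0\<close> on non-measurable sets.
\<close>
definition radon_measure :: "'a::topological_space measure \<Rightarrow> bool" where
  "radon_measure \<mu> \<longleftrightarrow>
     sets \<mu> = sets borel \<and>
     (\<forall>x. \<exists>U. open U \<and> x \<in> U \<and> emeasure \<mu> U < \<infinity>) \<and>
     (\<forall>A\<in>sets borel.
        emeasure \<mu> A = (SUP C\<in>{C. compact C \<and> C \<in> sets borel \<and> C \<subseteq> A}. emeasure \<mu> C))"

text \<open>
  The library restricts \<^const>\<open>has_bochner_integral\<close> and \<^const>\<open>lebesgue_integral\<close> to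
  second countable, i.e. separable, spaces. The following two definitions repeat the library ones
  verbatim without that restriction. Strong measurability needs no separate clause: approximation
  by simple functions in the \<open>L\<^sup>1\<close> sense forces \<open>f\<close> to be almost everywhere separably valued.
\<close>
definition has_banach_integral ::
    "'a measure \<Rightarrow> ('a \<Rightarrow> 'b::real_normed_vector) \<Rightarrow> 'b \<Rightarrow> bool" where
  "has_banach_integral M f I \<longleftrightarrow>
     f \<in> borel_measurable M \<and>
     (\<exists>s. (\<forall>i. Bochner_Integration.simple_bochner_integrable M (s i)) \<and>
          (\<lambda>i::nat. \<integral>\<^sup>+x. norm (f x - s i x) \<partial>M) \<longlonglongrightarrow> 0 \<and>
          (\<lambda>i. Bochner_Integration.simple_bochner_integral M (s i)) \<longlonglongrightarrow> I)"

definition banach_integral :: "'a measure \<Rightarrow> ('a \<Rightarrow> 'b::real_normed_vector) \<Rightarrow> 'b" where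
  "banach_integral M f =
     (if \<exists>I. has_banach_integral M f I then THE I. has_banach_integral M f I else 0)"

lemma has_banach_integral_eq_has_bochner_integral:
  fixes f :: "'a \<Rightarrow> 'b::{real_normed_vector, second_countable_topology}"
  shows "has_banach_integral M f I \<longleftrightarrow> has_bochner_integral M f I"
  unfolding has_banach_integral_def has_bochner_integral.simps by auto

lemma banach_integral_eq_lebesgue_integral:
  fixes f :: "'a \<Rightarrow> 'b::{real_normed_vector, second_countable_topology}"
  shows "banach_integral M f = integral\<^sup>L M f"
  unfolding banach_integral_def lebesgue_integral_def
    has_banach_integral_eq_has_bochner_integral ..

end

theory Submission
  imports Defs
begin

text \<open>
  With \<open>\<parallel>x\<parallel> = sup \<parallel>x t\<parallel> / l t\<close> the integral operator is a contraction: its Lipschitz constant is the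
  maximum of the continuous function \<open>t \<mapsto> (\<integral> L t s * l s d\<mu>) / l t\<close>, which is less than \<open>1\<close> because
  it is attained on the compact space. A continuous function on a compact space has totally bounded
  range, so it is a uniform limit of simple functions; since \<open>\<mu>\<close> is finite, this makes it Bochner
  integrable even when \<open>B\<close> is not separable.
\<close>

section \<open>Bochner integration without separability of the target space\<close>

text \<open>Without separability, a difference of measurable functions need not be measurable. Here
  \<open>s\<close> has only finitely many values, so the function is glued from the pieces
  \<open>norm (f x - c)\<close>, each a continuous function of \<open>f x\<close>.\<close>

lemma borel_measurable_norm_diff_simple_function:
  fixes f s :: "'a \<Rightarrow> 'b::real_normed_vector"
  assumes f: "f \<in> borel_measurable M" and s: "simple_function M s"
  shows "(\<lambda>x. norm (f x - s x)) \<in> borel_measurable M"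
proof (rule measurable_compose_countable'[where I = "s ` space M" and g = s
      and f = "\<lambda>c x. norm (f x - c)"])
  fix c :: 'b
  have "(\<lambda>y. norm (y - c)) \<in> borel_measurable borel"
    by (intro borel_measurable_continuous_onI continuous_intros)
  then show "(\<lambda>x. norm (f x - c)) \<in> borel_measurable M"
    by (rule measurable_compose[OF f])
next
  have "finite (s ` space M)"
    using s by (simp add: simple_function_def)
  then show "countable (s ` space M)" by (rule countable_finite)
  show "s \<in> measurable M (count_space (s ` space M))"
    using s by (simp add: simple_function_def measurable_count_space_eq2)
qed

lemma simple_bochner_integrable_imp_simple_function:
  "Bochner_Integration.simple_bochner_integrable M s \<Longrightarrow> simple_function M s"
  by (auto elim: Bochner_Integration.simple_bochner_integrable.cases)

lemma norm_diff_simple_bochner_integral_le: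
  fixes s t :: "'a \<Rightarrow> 'b::real_normed_vector"
  assumes s: "Bochner_Integration.simple_bochner_integrable M s"
    and t: "Bochner_Integration.simple_bochner_integrable M t"
  shows "ennreal (norm (Bochner_Integration.simple_bochner_integral M s -
      Bochner_Integration.simple_bochner_integral M t)) \<le> (\<integral>\<^sup>+x. norm (s x - t x) \<partial>M)"
proof -
  have "ennreal (norm (Bochner_Integration.simple_bochner_integral M s -
      Bochner_Integration.simple_bochner_integral M t)) =
    norm (Bochner_Integration.simple_bochner_integral M (\<lambda>x. s x - t x))"
    using s t by (subst simple_bochner_integral_diff) auto
  also have "\<dots> \<le> Bochner_Integration.simple_bochner_integral M (\<lambda>x. norm (s x - t x))"
    using simple_bochner_integrable_compose2[of "(-)" M s t] s t
    by (auto intro!: simple_bochner_integral_norm_bound)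
  also have "\<dots> = (\<integral>\<^sup>+x. norm (s x - t x) \<partial>M)"
    using simple_bochner_integrable_compose2[of "\<lambda>x y. norm (x - y)" M s t] s t
    by (auto intro!: simple_bochner_integral_eq_nn_integral)
  finally show ?thesis .
qed

text \<open>The estimate for simple functions passes to the limit along the approximating sequences
  of \<open>g\<close> and \<open>h\<close>. The measurable majorant \<open>w\<close> stands in for
  \<open>norm (g x - h x)\<close>, whose measurability does not follow from that of \<open>g\<close>
  and \<open>h\<close> alone. The cases \<open>w = 0\<close>, \<open>w\<close> constant and
  \<open>w\<close> continuous later give uniqueness, a Cauchy estimate and the contraction
  bound.\<close>

lemma norm_diff_has_banach_integral_le:
  fixes g h :: "'a \<Rightarrow> 'b::real_normed_vector"
  assumes g: "has_banach_integral M g I" and h: "has_banach_integral M h J"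
    and w: "w \<in> borel_measurable M"
    and le: "\<And>x. x \<in> space M \<Longrightarrow> norm (g x - h x) \<le> w x"
  shows "ennreal (norm (I - J)) \<le> (\<integral>\<^sup>+x. ennreal (w x) \<partial>M)"
proof -
  obtain s where s: "\<And>i::nat. Bochner_Integration.simple_bochner_integrable M (s i)"
    and s0: "(\<lambda>i. \<integral>\<^sup>+x. norm (g x - s i x) \<partial>M) \<longlonglongrightarrow> 0"
    and sI: "(\<lambda>i. Bochner_Integration.simple_bochner_integral M (s i)) \<longlonglongrightarrow> I"
    and gm: "g \<in> borel_measurable M"
    using g unfolding has_banach_integral_def by blast
  obtain t where t: "\<And>i::nat. Bochner_Integration.simple_bochner_integrable M (t i)"
    and t0: "(\<lambda>i. \<integral>\<^sup>+x. norm (h x - t i x) \<partial>M) \<longlonglongrightarrow> 0"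
    and tJ: "(\<lambda>i. Bochner_Integration.simple_bochner_integral M (t i)) \<longlonglongrightarrow> J"
    and hm: "h \<in> borel_measurable M"
    using h unfolding has_banach_integral_def by blast
  have [measurable]: "(\<lambda>x. norm (g x - s i x)) \<in> borel_measurable M"
      "(\<lambda>x. norm (h x - t i x)) \<in> borel_measurable M" for i
    using gm hm s t simple_bochner_integrable_imp_simple_function
    by (auto intro!: borel_measurable_norm_diff_simple_function)
  note w[measurable]
  have "ennreal (norm (Bochner_Integration.simple_bochner_integral M (s i) -
        Bochner_Integration.simple_bochner_integral M (t i)))
     \<le> (\<integral>\<^sup>+x. norm (g x - s i x) \<partial>M) + (\<integral>\<^sup>+x. ennreal (w x) \<partial>M) + (\<integral>\<^sup>+x. norm (h x - t i x) \<partial>M)"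
    for i
  proof -
    have "norm (s i x - t i x) \<le> norm (g x - s i x) + w x + norm (h x - t i x)"
      if "x \<in> space M" for x
    proof -
      have "s i x - t i x = - (g x - s i x) + (g x - h x) + (h x - t i x)" by simp
      then have "norm (s i x - t i x)
          \<le> norm (- (g x - s i x)) + norm (g x - h x) + norm (h x - t i x)"
        by (metis add_right_mono norm_triangle_ineq order_trans)
      then show ?thesis using le[OF that] by (simp add: norm_minus_commute)
    qed
    then have "ennreal (norm (s i x - t i x))
        \<le> ennreal (norm (g x - s i x)) + ennreal (w x) + ennreal (norm (h x - t i x))"
      if "x \<in> space M" for x
      \<comment> \<open>The last fact gives \<open>0 \<le> w x\<close>, without which
        \<open>ennreal\<close> would not be additive here.\<close>
      using that le[OF that] order_trans[OF norm_ge_zero le[OF that]]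
      by (simp flip: ennreal_plus add: ennreal_leI)
    then have "(\<integral>\<^sup>+x. norm (s i x - t i x) \<partial>M)
      \<le> (\<integral>\<^sup>+x. ennreal (norm (g x - s i x)) + ennreal (w x) + ennreal (norm (h x - t i x)) \<partial>M)"
      by (rule nn_integral_mono)
    also have "\<dots> = (\<integral>\<^sup>+x. norm (g x - s i x) \<partial>M) + (\<integral>\<^sup>+x. ennreal (w x) \<partial>M)
        + (\<integral>\<^sup>+x. norm (h x - t i x) \<partial>M)"
      by (simp add: nn_integral_add)
    finally show ?thesis
      using norm_diff_simple_bochner_integral_le[OF s t] order_trans by blast
  qed
  moreover have "(\<lambda>i. (\<integral>\<^sup>+x. norm (g x - s i x) \<partial>M) + (\<integral>\<^sup>+x. ennreal (w x) \<partial>M)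
        + (\<integral>\<^sup>+x. norm (h x - t i x) \<partial>M)) \<longlonglongrightarrow> 0 + (\<integral>\<^sup>+x. ennreal (w x) \<partial>M) + 0"
    by (intro tendsto_add s0 t0 tendsto_const)
  moreover have "(\<lambda>i. ennreal (norm (Bochner_Integration.simple_bochner_integral M (s i) -
        Bochner_Integration.simple_bochner_integral M (t i)))) \<longlonglongrightarrow> ennreal (norm (I - J))"
    by (intro tendsto_ennrealI tendsto_norm tendsto_diff sI tJ)
  ultimately show ?thesis
    using LIMSEQ_le by fastforce
qed

text \<open>Two integrals of the same \<open>f\<close> are compared with majorant \<open>0\<close>,
  so they coincide and the description operator \<open>THE\<close> is well defined.\<close>

lemma banach_integral_eqI:
  assumes "has_banach_integral M f I"
  shows "banach_integral M f = I"
proof -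
  have uniq: "J = I" if "has_banach_integral M f J" for J
    using norm_diff_has_banach_integral_le[OF that assms, of "\<lambda>_. 0"] by (simp add: ennreal_eq_0_iff)
  have "banach_integral M f = (THE I. has_banach_integral M f I)"
    unfolding banach_integral_def using assms by (intro if_P exI)
  also have "\<dots> = I"
    using assms uniq by (rule the_equality)
  finally show ?thesis .
qed

lemma has_banach_integral_simple_bochner_integral:
  assumes s: "Bochner_Integration.simple_bochner_integrable M s"
  shows "has_banach_integral M s (Bochner_Integration.simple_bochner_integral M s)"
  unfolding has_banach_integral_def
proof (intro conjI exI[of _ "\<lambda>_. s"] allI)
  show "s \<in> borel_measurable M"
    using measurable_compose[OF measurable_simple_function[OF
        simple_bochner_integrable_imp_simple_function[OF s]], of "\<lambda>x. x" borel]
    by simp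
qed (use s in simp_all)

text \<open>Each \<open>x\<close> is sent to the first centre of a finite net of radius
  \<open>e\<close> whose ball contains \<open>f x\<close>. Preimages of balls are measurable, and
  the finite measure bounds the support.\<close>

lemma uniform_approx_simple_bochner_integrable:
  fixes f :: "'a \<Rightarrow> 'b::real_normed_vector"
  assumes "finite_measure M" and f: "f \<in> borel_measurable M"
    and tb: "\<forall>e>0. \<exists>k. finite k \<and> f ` space M \<subseteq> (\<Union>c\<in>k. ball c e)" and "e > 0"
  obtains s where "Bochner_Integration.simple_bochner_integrable M s"
    and "\<And>x. x \<in> space M \<Longrightarrow> norm (f x - s x) < e"
proof -
  interpret finite_measure M by fact
  obtain k where "finite k" and k: "f ` space M \<subseteq> (\<Union>c\<in>k. ball c e)"
    using tb \<open>e > 0\<close> by blast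
  \<comment> \<open>Listing the centres turns the choice among overlapping balls into a least index,
    which depends measurably on \<open>x\<close>.\<close>
  obtain cs where cs: "set cs = k" using finite_list[OF \<open>finite k\<close>] by blast
  define P where "P i x \<longleftrightarrow> i < length cs \<and> f x \<in> ball (cs ! i) e" for i x
  define idx where "idx x = (LEAST i. P i x)" for x
  define s where "s x = cs ! idx x" for x
  have ex: "\<exists>i. P i x" if "x \<in> space M" for x
  proof -
    have "f x \<in> (\<Union>c\<in>k. ball c e)" using k that by (rule subsetD[OF _ imageI])
    then obtain c where "c \<in> set cs" "f x \<in> ball c e" unfolding cs by (rule UN_E)
    then show ?thesis unfolding P_def by (metis in_set_conv_nth)
  qed
  have P: "P (idx x) x" if "x \<in> space M" for x
    unfolding idx_def using LeastI_ex[OF ex[OF that]] .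
  have "Measurable.pred M (P i)" for i
  proof -
    have "f -` ball (cs ! i) e \<inter> space M \<in> sets M"
      by (intro measurable_sets[OF f]) auto
    moreover have "{x \<in> space M. P i x} = (if i < length cs then f -` ball (cs ! i) e \<inter> space M else {})"
      by (auto simp: P_def)
    ultimately show ?thesis by (simp add: pred_def)
  qed
  then have idx_meas: "idx \<in> measurable M (count_space UNIV)"
    unfolding idx_def by (rule measurable_Least)
  have "idx ` space M \<subseteq> {..<length cs}" using P by (auto simp: P_def)
  then have "finite (idx ` space M)" by (rule finite_subset) simp
  then have "simple_function M idx"
    using idx_meas by (auto simp: simple_function_def measurable_def)
  then have "simple_function M s" unfolding s_def by (rule simple_function_compose1)
  moreover have "emeasure M {y \<in> space M. s y \<noteq> 0} \<noteq> \<infinity>" by simp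
  ultimately have "Bochner_Integration.simple_bochner_integrable M s"
    by (rule Bochner_Integration.simple_bochner_integrable.intros)
  moreover have "norm (f x - s x) < e" if "x \<in> space M" for x
    using P[OF that] by (simp add: P_def s_def dist_norm norm_minus_commute)
  ultimately show ?thesis by (rule that)
qed

text \<open>Simple functions uniformly within \<open>1 / (n + 1)\<close> of \<open>f\<close> have
  integrals forming a Cauchy sequence, because the total mass \<open>m\<close> is finite.
  Completeness of \<open>'b\<close> supplies the limit, and the error in the mean is at most
  \<open>m / (n + 1)\<close>.\<close>

lemma has_banach_integral_banach_integral:
  fixes f :: "'a \<Rightarrow> 'b::banach"
  assumes fin: "finite_measure M" and f: "f \<in> borel_measurable M"
    and tb: "\<forall>e>0. \<exists>k. finite k \<and> f ` space M \<subseteq> (\<Union>c\<in>k. ball c e)"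
  shows "has_banach_integral M f (banach_integral M f)"
proof -
  interpret finite_measure M by fact
  define m where "m = measure M (space M)"
  have "m \<ge> 0" by (simp add: m_def)
  have cint: "(\<integral>\<^sup>+x. ennreal c \<partial>M) = ennreal (c * m)" if "c \<ge> 0" for c
    using that by (simp add: m_def emeasure_eq_measure ennreal_mult)
  let ?e = "\<lambda>n::nat. inverse (real (Suc n))"
  have "\<exists>s. Bochner_Integration.simple_bochner_integrable M s \<and>
      (\<forall>x\<in>space M. norm (f x - s x) < ?e n)" for n
    using uniform_approx_simple_bochner_integrable[OF fin f tb, of "?e n"]
    by (metis inverse_positive_iff_positive of_nat_0_less_iff zero_less_Suc)
  then obtain s where s: "\<And>n. Bochner_Integration.simple_bochner_integrable M (s n)"
    and sf: "\<And>n x. x \<in> space M \<Longrightarrow> norm (f x - s n x) < ?e n"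
    by metis
  let ?I = "\<lambda>n. Bochner_Integration.simple_bochner_integral M (s n)"
  have bound: "norm (?I i - ?I j) \<le> (?e i + ?e j) * m" for i j
  proof -
    have "norm (s i x - s j x) \<le> ?e i + ?e j" if "x \<in> space M" for x
    proof -
      have "norm (s i x - s j x) \<le> norm (f x - s j x) + norm (f x - s i x)"
        using norm_triangle_ineq4[of "f x - s j x" "f x - s i x"] by simp
      then show ?thesis using sf[OF that, of i] sf[OF that, of j] by linarith
    qed
    then have "ennreal (norm (?I i - ?I j)) \<le> (\<integral>\<^sup>+x. ennreal (?e i + ?e j) \<partial>M)"
      by (intro norm_diff_has_banach_integral_le[of M "s i" _ "s j"]
          has_banach_integral_simple_bochner_integral s) auto
    also have "\<dots> = ennreal ((?e i + ?e j) * m)" by (rule cint) simp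
    finally show ?thesis using \<open>m \<ge> 0\<close> by (subst (asm) ennreal_le_iff) auto
  qed
  have e0: "?e \<longlonglongrightarrow> 0" by (rule LIMSEQ_inverse_real_of_nat)
  have "Cauchy ?I"
  proof (rule metric_CauchyI)
    fix d :: real assume "d > 0"
    \<comment> \<open>Since \<open>?e\<close> decreases, \<open>2 * ?e N * m\<close> dominates
      \<open>(?e i + ?e j) * m\<close> for all \<open>i\<close> and \<open>j\<close> from
      \<open>N\<close> on.\<close>
    have "(\<lambda>n. 2 * ?e n * m) \<longlonglongrightarrow> 2 * 0 * m" by (intro tendsto_intros e0)
    then have "\<forall>\<^sub>F n in sequentially. 2 * ?e n * m < d"
      using \<open>d > 0\<close> by (intro order_tendstoD(2)) auto
    then obtain N where N: "2 * ?e N * m < d" 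
      unfolding eventually_sequentially by blast
    have "dist (?I i) (?I j) < d" if "i \<ge> N" "j \<ge> N" for i j
    proof -
      have "?e n \<le> ?e N" if "n \<ge> N" for n
        using that by (intro le_imp_inverse_le) simp_all
      from this[OF that(1)] this[OF that(2)] have "?e i + ?e j \<le> 2 * ?e N" by linarith
      then have "(?e i + ?e j) * m \<le> 2 * ?e N * m" using \<open>m \<ge> 0\<close> by (rule mult_right_mono)
      then show ?thesis using bound[of i j] N by (simp add: dist_norm)
    qed
    then show "\<exists>N. \<forall>i\<ge>N. \<forall>j\<ge>N. dist (?I i) (?I j) < d" by blast
  qed
  then obtain I where I: "?I \<longlonglongrightarrow> I" by (metis Cauchy_convergent_iff convergent_def)
  have "(\<lambda>n. \<integral>\<^sup>+x. norm (f x - s n x) \<partial>M) \<longlonglongrightarrow> 0"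
  proof (rule tendsto_sandwich[where f = "\<lambda>_. 0" and h = "\<lambda>n. ennreal (?e n * m)"])
    have "(\<lambda>n. ennreal (?e n * m)) \<longlonglongrightarrow> ennreal (0 * m)"
      by (intro tendsto_ennrealI tendsto_intros e0)
    then show "(\<lambda>n. ennreal (?e n * m)) \<longlonglongrightarrow> 0" by simp
    have "(\<integral>\<^sup>+x. norm (f x - s n x) \<partial>M) \<le> (\<integral>\<^sup>+x. ennreal (?e n) \<partial>M)" for n
      by (intro nn_integral_mono ennreal_leI less_imp_le sf)
    then show "\<forall>\<^sub>F n in sequentially. (\<integral>\<^sup>+x. norm (f x - s n x) \<partial>M) \<le> ennreal (?e n * m)"
      by (subst (asm) cint) auto
  qed auto
  then have "has_banach_integral M f I"
    unfolding has_banach_integral_def using f s I by blast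
  then show ?thesis using banach_integral_eqI by metis
qed

section \<open>Integrals of continuous functions over a compact space\<close>

text \<open>Finitely many neighbourhoods of finite measure cover the compact space, and
  subadditivity bounds the total mass.\<close>

lemma radon_measure_finite:
  assumes "compact (UNIV :: 'a::topological_space set)" and \<mu>: "radon_measure (\<mu> :: 'a measure)"
  shows "finite_measure \<mu>"
proof (rule finite_measureI)
  have sets: "sets \<mu> = sets borel" using \<mu> by (simp add: radon_measure_def)
  obtain U where U: "\<And>x. open (U x)" "\<And>x. x \<in> U x" "\<And>x. emeasure \<mu> (U x) < \<infinity>"
  proof -
    have "\<forall>x. \<exists>U. open U \<and> x \<in> U \<and> emeasure \<mu> U < \<infinity>"
      using \<mu> by (simp add: radon_measure_def)
    then show ?thesis using that by (elim choice[THEN exE]) blast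
  qed
  obtain C where C: "finite C" "UNIV \<subseteq> (\<Union>x\<in>C. U x)"
    by (rule compactE_image[OF assms(1), of UNIV U]) (use U in auto)
  have "emeasure \<mu> (space \<mu>) \<le> emeasure \<mu> (\<Union>x\<in>C. U x)"
    using C sets U(1) by (intro emeasure_mono) auto
  also have "\<dots> \<le> (\<Sum>x\<in>C. emeasure \<mu> (U x))"
    using C sets U(1) by (intro emeasure_subadditive_finite) auto
  also have "\<dots> < \<infinity>" using U(3) C(1) by (simp add: less_top)
  finally show "emeasure \<mu> (space \<mu>) \<noteq> \<infinity>" by simp
qed

context
  fixes \<mu> :: "'a::topological_space measure"
  assumes compact: "compact (UNIV :: 'a set)" and sets: "sets \<mu> = sets borel"
    and fin: "finite_measure \<mu>"
begin

lemma space_eq_UNIV: "space \<mu> = UNIV"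
  using sets_eq_imp_space_eq[OF sets] by simp

lemma borel_measurable_continuous:
  "continuous_on UNIV g \<Longrightarrow> g \<in> borel_measurable \<mu>"
  using borel_measurable_continuous_onI measurable_cong_sets[OF sets refl] by blast

lemma continuous_has_banach_integral:
  fixes g :: "'a \<Rightarrow> 'b::banach"
  assumes g: "continuous_on UNIV g"
  shows "has_banach_integral \<mu> g (banach_integral \<mu> g)"
proof (rule has_banach_integral_banach_integral[OF fin borel_measurable_continuous[OF g]])
  have "compact (range g)" using compact_continuous_image[OF g compact] .
  then show "\<forall>e>0. \<exists>k. finite k \<and> g ` space \<mu> \<subseteq> (\<Union>c\<in>k. ball c e)"
    using seq_compact_imp_totally_bounded compact_imp_seq_compact
    by (metis space_eq_UNIV)
qed

text \<open>The reals are second countable, so the two notions of integral agree.\<close>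

lemma continuous_integrable:
  fixes g :: "'a \<Rightarrow> real"
  assumes "continuous_on UNIV g"
  shows "integrable \<mu> g"
  using continuous_has_banach_integral[OF assms]
  unfolding has_banach_integral_eq_has_bochner_integral integrable.simps by blast

lemma norm_banach_integral_diff_le:
  fixes g h :: "'a \<Rightarrow> 'b::banach"
  assumes g: "continuous_on UNIV g" and h: "continuous_on UNIV h"
    and w: "continuous_on UNIV w" and le: "\<And>x. norm (g x - h x) \<le> w x"
  shows "norm (banach_integral \<mu> g - banach_integral \<mu> h) \<le> (LINT x|\<mu>. w x)"
proof -
  have w0: "w x \<ge> 0" for x using order_trans[OF norm_ge_zero le] .
  have "ennreal (norm (banach_integral \<mu> g - banach_integral \<mu> h)) \<le> (\<integral>\<^sup>+x. ennreal (w x) \<partial>\<mu>)"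
    by (rule norm_diff_has_banach_integral_le[OF continuous_has_banach_integral[OF g]
          continuous_has_banach_integral[OF h] borel_measurable_continuous[OF w] le])
  also have "\<dots> = ennreal (LINT x|\<mu>. w x)"
    by (rule nn_integral_eq_integral[OF continuous_integrable[OF w]]) (simp add: w0)
  finally show ?thesis by (simp add: ennreal_le_iff integral_nonneg w0)
qed

text \<open>Compactness in the second variable makes \<open>g t\<close> uniformly close to
  \<open>g t0\<close> for \<open>t\<close> near \<open>t0\<close>; integrating this constant bound
  over a finite measure gives continuity at \<open>t0\<close>.\<close>

lemma continuous_on_banach_integral:
  fixes g :: "'a \<Rightarrow> 'a \<Rightarrow> 'b::banach"
  assumes g: "continuous_on UNIV (\<lambda>(t, s). g t s)"
  shows "continuous_on UNIV (\<lambda>t. banach_integral \<mu> (g t))"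
proof -
  interpret finite_measure \<mu> by (rule fin)
  have gt: "continuous_on UNIV (g t)" for t
    using continuous_on_compose2[OF g, of UNIV "\<lambda>s. (t, s)"] by (simp add: continuous_intros)
  define m where "m = measure \<mu> (space \<mu>)"
  have "m \<ge> 0" by (simp add: m_def)
  have "((\<lambda>t. banach_integral \<mu> (g t)) \<longlongrightarrow> banach_integral \<mu> (g t0)) (at t0)" for t0
  proof (rule tendstoI)
    fix e :: real assume "e > 0"
    \<comment> \<open>The summand \<open>1\<close> covers the case \<open>m = 0\<close> and makes
      \<open>m * d < e\<close> strict.\<close>
    define d where "d = e / (m + 1)"
    have "d > 0" using \<open>e > 0\<close> \<open>m \<ge> 0\<close> by (simp add: d_def)
    have "continuous_on (UNIV \<times> UNIV) (\<lambda>(t, s). g t s)" using g by simp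
    from continuous_on_prod_compactE[OF this compact UNIV_I \<open>d > 0\<close>, of t0]
    obtain X0 where X0: "t0 \<in> X0" "open X0" "\<And>t s. t \<in> X0 \<Longrightarrow> dist (g t s) (g t0 s) \<le> d"
      unfolding prod.case by (metis IntI UNIV_I)
    have "dist (banach_integral \<mu> (g t)) (banach_integral \<mu> (g t0)) < e" if "t \<in> X0" for t
    proof -
      have "norm (banach_integral \<mu> (g t) - banach_integral \<mu> (g t0)) \<le> (LINT s|\<mu>. d)"
        using X0(3) that by (intro norm_banach_integral_diff_le gt) (auto simp: dist_norm)
      also have "\<dots> = m * d" by (simp add: m_def)
      also have "\<dots> < e" using \<open>e > 0\<close> \<open>m \<ge> 0\<close> by (simp add: d_def field_simps)
      finally show ?thesis by (simp add: dist_norm)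
    qed
    then show "\<forall>\<^sub>F t in at t0. dist (banach_integral \<mu> (g t)) (banach_integral \<mu> (g t0)) < e"
      using X0(1,2) eventually_at_topological by blast
  qed
  then show ?thesis by (simp add: continuous_on_def)
qed

end

section \<open>Fixed points of contractions in a weighted supremum norm\<close>

text \<open>The library has this only as a class instance whose domain is a metric space.\<close>
lemma complete_UNIV_bcontfun:
  "complete (UNIV :: ('a::topological_space \<Rightarrow>\<^sub>C 'b::complete_space) set)"
  unfolding complete_def
proof (intro allI impI, elim conjE)
  fix f :: "nat \<Rightarrow> ('a, 'b) bcontfun"
  assume "Cauchy f"
  \<comment> \<open>The conjunct \<open>True\<close> fills the domain predicate of the uniform
    Cauchy criterion, so convergence is uniform on the whole space.\<close>
  have "\<exists>g. \<forall>e>0. \<exists>N. \<forall>n x. N \<le> n \<and> True \<longrightarrow> dist (f n x) (g x) < e"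
  proof (rule iffD2[OF uniformly_convergent_eq_cauchy], intro allI impI)
    fix e :: real assume "e > 0"
    then obtain N where N: "\<And>m n. m \<ge> N \<Longrightarrow> n \<ge> N \<Longrightarrow> dist (f m) (f n) < e"
      using \<open>Cauchy f\<close> unfolding Cauchy_def by meson
    show "\<exists>N. \<forall>m n x. N \<le> m \<and> N \<le> n \<and> True \<longrightarrow> dist (f m x) (f n x) < e"
      by (intro exI[of _ N]) (simp add: N dist_fun_lt_imp_dist_val_lt)
  qed
  then obtain g where "uniform_limit UNIV f g sequentially"
    unfolding uniform_limit_sequentially_iff by auto
  from uniform_limit_bcontfunE[OF this sequentially_bot]
  obtain h where "f \<longlonglongrightarrow> h" by metis
  then show "\<exists>l\<in>UNIV. f \<longlonglongrightarrow> l" by (rule bexI) simp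
qed

text \<open>Division by \<open>l\<close> carries the weighted norm to the supremum norm on bounded
  continuous functions, where Banach's theorem applies. In \<open>lip\<close> any bound
  \<open>r\<close> on the weighted distance serves, so no supremum has to be formed.\<close>

lemma weighted_fixed_point:
  fixes T :: "('a::topological_space \<Rightarrow> 'b::banach) \<Rightarrow> 'a \<Rightarrow> 'b"
  assumes compact: "compact (UNIV :: 'a set)"
    and l: "continuous_on UNIV l" "\<And>t. l t > (0::real)" and c: "0 \<le> c" "c < 1"
    and T: "\<And>x. continuous_on UNIV x \<Longrightarrow> continuous_on UNIV (T x)"
    and lip: "\<And>x y r t. continuous_on UNIV x \<Longrightarrow> continuous_on UNIV y \<Longrightarrow>
       (\<And>s. norm (x s - y s) \<le> r * l s) \<Longrightarrow> norm (T x t - T y t) \<le> c * r * l t"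
  shows "\<exists>!x. continuous_on UNIV x \<and> (\<forall>t. x t = T x t)"
proof -
  have l0: "l t \<noteq> 0" for t using l(2)[of t] by simp
  have bc: "u \<in> bcontfun" if "continuous_on UNIV u" for u :: "'a \<Rightarrow> 'b"
    using that compact_continuous_image[OF that compact] by (auto simp: bcontfun_def compact_imp_bounded)
  \<comment> \<open>\<open>E\<close> multiplies by \<open>l\<close> and \<open>D\<close> divides by
    it. By compactness every continuous function is bounded, so \<open>D\<close> is meaningful on
    all of them.\<close>
  define E where "E u = (\<lambda>t. l t *\<^sub>R apply_bcontfun u t)" for u :: "'a \<Rightarrow>\<^sub>C 'b"
  define D where "D x = Bcontfun (\<lambda>t. x t /\<^sub>R l t)" for x :: "'a \<Rightarrow> 'b"
  have E: "continuous_on UNIV (E u)" for u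
    unfolding E_def by (intro continuous_on_scaleR l continuous_on_apply_bcontfun)
  have D: "apply_bcontfun (D x) = (\<lambda>t. x t /\<^sub>R l t)" if "continuous_on UNIV x" for x
    unfolding D_def using that
    by (intro Bcontfun_inverse bc continuous_intros l) (auto simp: l0)
  have ED: "E (D x) = x" if "continuous_on UNIV x" for x
    unfolding E_def D[OF that] by (simp add: l0)
  have "dist (D (T (E u))) (D (T (E v))) \<le> c * dist u v" for u v
  proof (rule dist_bound)
    fix t
    \<comment> \<open>This is the premise of \<open>lip\<close> with
      \<open>r = dist u v\<close>.\<close>
    have "norm (E u s - E v s) \<le> dist u v * l s" for s
      using dist_bounded[of u s v] l(2)[of s]
      by (simp add: E_def dist_norm mult.commute flip: scaleR_diff_right)
    then have "norm (T (E u) t - T (E v) t) \<le> c * dist u v * l t"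
      by (intro lip E)
    moreover have "dist (D (T (E u)) t) (D (T (E v)) t) = norm (T (E u) t - T (E v) t) / l t"
      unfolding D[OF T[OF E]] dist_norm scaleR_diff_right[symmetric] norm_scaleR
      using l(2)[of t] by (simp add: divide_inverse_commute)
    ultimately show "dist (D (T (E u)) t) (D (T (E v)) t) \<le> c * dist u v"
      using l(2)[of t] by (simp add: pos_divide_le_eq)
  qed
  then have "\<exists>!u\<in>UNIV. D (T (E u)) = u"
    by (intro Banach_fix[OF complete_UNIV_bcontfun UNIV_not_empty c]) auto
  then obtain u where u: "D (T (E u)) = u" and uniq: "\<And>v. D (T (E v)) = v \<Longrightarrow> v = u" by auto
  show ?thesis
  \<comment> \<open>Conjugation matches fixed points: applying \<open>E\<close> to
    \<open>D (T (E u)) = u\<close> gives \<open>T (E u) = E u\<close>, and a continuous fixed point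
    \<open>x\<close> of \<open>T\<close> yields the fixed point \<open>D x\<close> of the conjugate,
    so \<open>D x = u\<close>.\<close>
  proof (rule ex1I[of _ "E u"])
    show "continuous_on UNIV (E u) \<and> (\<forall>t. E u t = T (E u) t)"
      using E ED[OF T[OF E]] u by metis
    fix x assume "continuous_on UNIV x \<and> (\<forall>t. x t = T x t)"
    then have x: "continuous_on UNIV x" "T x = x" by auto
    then have "D (T (E (D x))) = D x" by (simp add: ED)
    then show "x = E u" using uniq ED[OF x(1)] by metis
  qed
qed

section \<open>The Fredholm equation as a fixed-point problem\<close>

theorem theorem4:
  fixes \<mu> :: "'a::topological_space measure"
    and K :: "'a \<Rightarrow> 'a \<Rightarrow> 'b::banach \<Rightarrow> 'b"
    and L :: "'a \<Rightarrow> 'a \<Rightarrow> real"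
    and f :: "'a \<Rightarrow> 'b"
  assumes "compact (UNIV :: 'a set)"
    and "radon_measure \<mu>"
    and "continuous_on UNIV (\<lambda>(t, s, x). K t s x)"
    and "continuous_on UNIV (\<lambda>(t, s). L t s)"
    and "\<forall>t s. L t s > 0"
    and "\<forall>t s x y. norm (K t s x - K t s y) \<le> L t s * norm (x - y)"
    and "continuous_on UNIV f"
    and "\<exists>l :: 'a \<Rightarrow> real. continuous_on UNIV l \<and> (\<forall>t. l t > 0) \<and>
           (\<forall>t. (LINT s|\<mu>. L t s * l s) < l t)"
  shows "\<exists>!x. continuous_on UNIV x \<and>
           (\<forall>t. x t = f t + banach_integral \<mu> (\<lambda>s. K t s (x s)))"
proof -
  have sets: "sets \<mu> = sets borel" using assms(2) by (simp add: radon_measure_def)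
  note \<mu> = assms(1) sets radon_measure_finite[OF assms(1,2)]
  obtain l where l: "continuous_on UNIV l" "\<And>t. l t > 0"
    and Ll: "\<And>t. (LINT s|\<mu>. L t s * l s) < l t"
    using assms(8) by blast
  have L: "continuous_on UNIV (\<lambda>(t, s). L t s * l s)"
    using continuous_on_mult[OF assms(4) continuous_on_compose2[OF l(1), of UNIV snd]]
    by (simp add: case_prod_unfold continuous_intros)
  have Lt: "continuous_on UNIV (\<lambda>s. L t s * l s)" for t
    using continuous_on_compose2[OF L, of UNIV "\<lambda>s. (t, s)"] by (simp add: continuous_intros)
  have K: "continuous_on UNIV (\<lambda>(t, s). K t s (x s))" if "continuous_on UNIV x" for x
    using continuous_on_compose2[OF assms(3), of UNIV "\<lambda>(t, s). (t, s, x s)"]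
      continuous_on_compose2[OF that, of UNIV "snd :: 'a \<times> 'a \<Rightarrow> 'a"]
    by (simp add: case_prod_unfold continuous_intros)
  have Kt: "continuous_on UNIV (\<lambda>s. K t s (x s))" if "continuous_on UNIV x" for x t
    using continuous_on_compose2[OF K[OF that], of UNIV "\<lambda>s. (t, s)"]
    by (simp add: continuous_intros)
  \<comment> \<open>\<open>q t\<close> is the local contraction factor at \<open>t\<close>. Its
    maximum \<open>q t1\<close>, attained by compactness, turns the pointwise strict inequalities
    into one constant below \<open>1\<close>.\<close>
  define q where "q t = (LINT s|\<mu>. L t s * l s) / l t" for t
  have "continuous_on UNIV (\<lambda>t. LINT s|\<mu>. L t s * l s)"
    using continuous_on_banach_integral[OF \<mu> L] by (simp add: banach_integral_eq_lebesgue_integral)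
  then have "continuous_on UNIV q"
    unfolding q_def using l by (intro continuous_intros) (auto simp: less_imp_neq[symmetric])
  then obtain t1 where t1: "\<And>t. q t \<le> q t1"
    using continuous_attains_sup[OF assms(1) UNIV_not_empty] by blast
  have "q t1 < 1" using Ll l by (simp add: q_def)
  have "0 \<le> L t1 s * l s" for s
    using assms(5) l(2)[of s] by (intro mult_nonneg_nonneg less_imp_le) auto
  then have "0 \<le> q t1"
    unfolding q_def by (intro divide_nonneg_pos Bochner_Integration.integral_nonneg l(2))
  have q: "(LINT s|\<mu>. L t s * l s) \<le> q t1 * l t" for t
    using t1[of t] l(2)[of t] by (simp add: q_def[of t] pos_divide_le_eq)
  show ?thesis
  proof (rule weighted_fixed_point[OF assms(1) l \<open>0 \<le> q t1\<close> \<open>q t1 < 1\<close>])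
    show "continuous_on UNIV (\<lambda>t. f t + banach_integral \<mu> (\<lambda>s. K t s (x s)))"
      if "continuous_on UNIV x" for x
      by (intro continuous_on_add assms(7) continuous_on_banach_integral[OF \<mu>] K that)
  next
    fix x y :: "'a \<Rightarrow> 'b" and r t
    assume x: "continuous_on UNIV x" and y: "continuous_on UNIV y"
      and r: "\<And>s. norm (x s - y s) \<le> r * l s"
    \<comment> \<open>At any point \<open>s\<close>, \<open>r * l s\<close> bounds a norm and
      \<open>l s\<close> is positive.\<close>
    have "0 \<le> r" using order_trans[OF norm_ge_zero r] l(2) by (metis zero_le_mult_iff not_less)
    have "norm (banach_integral \<mu> (\<lambda>s. K t s (x s)) - banach_integral \<mu> (\<lambda>s. K t s (y s)))
        \<le> (LINT s|\<mu>. r * (L t s * l s))"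
    \<comment> \<open>The majorant comes from the Lipschitz condition combined with the weighted
      bound \<open>r * l s\<close> on \<open>norm (x s - y s)\<close>.\<close>
    proof (rule norm_banach_integral_diff_le[OF \<mu> Kt[OF x] Kt[OF y]])
      show "continuous_on UNIV (\<lambda>s. r * (L t s * l s))" by (intro continuous_intros Lt)
      fix s
      have "norm (K t s (x s) - K t s (y s)) \<le> L t s * norm (x s - y s)" using assms(6) by blast
      also have "\<dots> \<le> L t s * (r * l s)"
        using assms(5) r by (intro mult_left_mono) (auto intro: less_imp_le)
      finally show "norm (K t s (x s) - K t s (y s)) \<le> r * (L t s * l s)" by (simp add: ac_simps)
    qed
    also have "\<dots> = r * (LINT s|\<mu>. L t s * l s)" by simp
    also have "\<dots> \<le> r * (q t1 * l t)" using q \<open>0 \<le> r\<close> by (rule mult_left_mono)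
    finally show "norm (f t + banach_integral \<mu> (\<lambda>s. K t s (x s)) -
        (f t + banach_integral \<mu> (\<lambda>s. K t s (y s)))) \<le> q t1 * r * l t"
      by (simp add: ac_simps)
  qed
qed

end
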